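(* Fix $h\in\{f,g\}$ and suppose that the bound $C_t^{(h)}<\infty$ holds for the times $t\ge 1$ under consideration. Suppose the squared tensor-train approximations $\hat\pi_t$ produced by the recursive algorithm satisfy $\|\sqrt{\hat\pi_t}-\sqrt{q_t}\|_{L^2}\le\epsilon_t$ at every time $t\geq 1$. Then for every $t>0$ the Hellinger distance between $p_t$ and its approximation $\hat p_t$ is bounded by $$D_{\rm H}(\hat p_t,p_t)\le\frac{\sqrt2}{\sqrt{p(y_{1:t})}}\sum_{k=1}^{t}C^{(t-k)/2}\epsilon_k,\qquad C=\sup_t C_t^{(h)},$$ where $p(y_{1:t})$ is the evidence.
   Context: State-space model. $\mathcal X\subseteq\mathbb R^m$ (states), $\mathcal Y\subseteq\mathbb R^n$ (data) and $\Theta\subseteq\mathbb R^d$ (parameters) are Cartesian products; all densities are with respect to Lebesgue measure. $p(\theta)$ and $p(x_0|\theta)$ are prior probability densities on $\Theta$ and $\mathcal X$; $f(x_t|x_{t-1},\theta)$ is a transition probability density in $x_t\in\mathcal X$ for each $(x_{t-1},\theta)$; $g(y_t|x_t,\theta)\ge 0$ is the likelihood. The data $y_1,y_2,\ldots$ are fixed. Exact unnormalized posterior densities: $\pi_1(x_1,\theta,x_0)=p(\theta)p(x_0|\theta)f(x_1|x_0,\theta)g(y_1|x_1,\theta)$ and, for $t\ge2$, $$\pi_t(x_t,\theta,x_{t-1})=\pi(x_{t-1},\theta|y_{1:t-1})\,f(x_t|x_{t-1},\theta)\,g(y_t|x_t,\theta),\qquad \pi(x_{t-1},\theta|y_{1:t-1})=\int\pi_{t-1}(x_{t-1},\theta,x_{t-2})\,dx_{t-2}.$$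 The evidence is $p(y_{1:t})=\int\pi_t\,dx_t\,d\theta\,dx_{t-1}$, which lies in $(0,\infty)$, and $p_t=\pi_t/p(y_{1:t})$ is the normalized posterior density. Recursive approximation algorithm. At time $t\ge1$ define $$q_t(x_t,\theta,x_{t-1})=\hat\pi(x_{t-1},\theta|y_{1:t-1})\,f(x_t|x_{t-1},\theta)\,g(y_t|x_t,\theta),$$ where for $t\ge2$, $\hat\pi(x_{t-1},\theta|y_{1:t-1})=\int\hat\pi_{t-1}(x_{t-1},\theta,x_{t-2})\,dx_{t-2}$ is the marginal of the previous approximation, and for $t=1$ it is the exact prior $p(\theta)p(x_0|\theta)$ (no approximation is made at time $0$). Then $$\hat\pi_t(x_t,\theta,x_{t-1})=\phi_t(x_t,\theta,x_{t-1})^2+\tau_t\,\lambda(x_t)\lambda(\theta)\lambda(x_{t-1}),$$ where $\phi_t\in L^2$ is a tensor train approximating $\sqrt{q_t}$ (a product of $2m+d$ matrix-valued functions of compatible finite sizes, first with one row, last with one column, each depending on a single scalar coordinate of $(x_t,\theta,x_{t-1})$), $\lambda(x_t)\lambda(\theta)\lambda(x_{t-1})$ is a reference probability density that is a product of univariate densities (with $q_t$ divided by it bounded), and $\tau_t>0$ is a constant with $\tau_t\le\|\phi_t-\sqrt{q_t}\|_{L^2}^2$. The normalized approximation is $\hat p_t=\hat\pi_t/\int\hat\pi_t$. Constants: $$C_t^{(g)}=\sup_{x_t\in\mathcal X,\theta\in\Theta}g(y_t|x_t,\theta),\qquad C_t^{(f)}=\sup_{x_{t-1}\in\mathcal X,\theta\in\Theta}\int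 f(x_t|x_{t-1},\theta)\,g(y_t|x_t,\theta)\,dx_t.$$ Hellinger distance: $D_{\rm H}(p,\hat p)=\big(\tfrac12\int(\sqrt{p}-\sqrt{\hat p})^2\big)^{1/2}$. $L^2$ norms are over $\mathcal X\times\Theta\times\mathcal X$ with Lebesgue measure. *)

theory Defs
  imports
    "HOL-Analysis.Analysis"
    "HOL-Library.Extended_Nat"
    "Jordan_Normal_Form.Matrix"
begin

text \<open>The symbol \<open>$\<close> denotes component access in \<open>real ^ 'n\<close> throughout; the matrices of a
  tensor train have varying finite sizes and are therefore taken from Jordan_Normal_Form.\<close>

no_notation Matrix.vec_index (infixl \<open>$\<close> 100)
no_notation Matrix.scalar_prod (infix \<open>\<bullet>\<close> 70)
hide_type (open) Matrix.vec
hide_const (open) Matrix.vec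

section \<open>Lebesgue measure on Cartesian product domains\<close>

abbreviation lborel_on :: "'a::euclidean_space set \<Rightarrow> 'a measure" where
  "lborel_on S \<equiv> restrict_space lborel S"

definition cart :: "('i::finite \<Rightarrow> real set) \<Rightarrow> (real ^ 'i) set" where
  "cart A = {x. \<forall>i. x $ i \<in> A i}"

definition prob_density_on :: "'a::euclidean_space set \<Rightarrow> ('a \<Rightarrow> real) \<Rightarrow> bool" where
  "prob_density_on S u \<longleftrightarrow>
     u \<in> borel_measurable (lborel_on S) \<and> (\<forall>x\<in>S. 0 \<le> u x) \<and>
     (\<integral>\<^sup>+x. ennreal (u x) \<partial>lborel_on S) = 1"

text \<open>A power \<open>C\<close> to \<open>j/2\<close>, for \<open>C\<close> in \<open>[0, \<infinity>]\<close> and a natural number \<open>j\<close>, is written \<open>ennsqrt C ^ j\<close>;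
  in particular it is \<open>1\<close> for \<open>j = 0\<close>, and \<open>\<infinity> * 0 = 0\<close> in \<open>ennreal\<close>.\<close>

definition ennsqrt :: "ennreal \<Rightarrow> ennreal" where
  "ennsqrt a = (if a = \<infinity> then \<infinity> else ennreal (sqrt (enn2real a)))"

text \<open>The norm and the Hellinger distance are extended-valued, so that a divergent integral
  counts as \<open>\<infinity>\<close> and not as \<open>0\<close>.\<close>

definition L2_norm_on :: "'a::euclidean_space set \<Rightarrow> ('a \<Rightarrow> real) \<Rightarrow> ennreal" where
  "L2_norm_on S u = ennsqrt (\<integral>\<^sup>+z. ennreal ((u z)\<^sup>2) \<partial>lborel_on S)"

definition hellinger_on :: "'a::euclidean_space set \<Rightarrow> ('a \<Rightarrow> real) \<Rightarrow> ('a \<Rightarrow> real) \<Rightarrow> ennreal" where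
  "hellinger_on S u v =
     ennsqrt (ennreal (1/2) * (\<integral>\<^sup>+z. ennreal ((sqrt (u z) - sqrt (v z))\<^sup>2) \<partial>lborel_on S))"

definition normalized_on :: "'a::euclidean_space set \<Rightarrow> ('a \<Rightarrow> real) \<Rightarrow> 'a \<Rightarrow> real" where
  "normalized_on S u = (\<lambda>z. u z / (\<integral>z'. u z' \<partial>lborel_on S))"

section \<open>State-space models\<close>

text \<open>Conditional densities take the conditioned variable first: \<open>transition M x' x \<theta>\<close> is
  \<open>f(x' | x, \<theta>)\<close>, \<open>lik M y x \<theta>\<close> is \<open>g(y | x, \<theta>)\<close>, \<open>prior_state M x \<theta>\<close> is \<open>p(x | \<theta>)\<close>.\<close>

record ('m, 'd, 'n) ssm =
  state_factor :: "'m::finite \<Rightarrow> real set"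
  param_factor :: "'d::finite \<Rightarrow> real set"
  data_factor :: "'n::finite \<Rightarrow> real set"
  prior_param :: "real ^ 'd \<Rightarrow> real"
  prior_state :: "real ^ 'm \<Rightarrow> real ^ 'd \<Rightarrow> real"
  transition :: "real ^ 'm \<Rightarrow> real ^ 'm \<Rightarrow> real ^ 'd \<Rightarrow> real"
  lik :: "real ^ 'n \<Rightarrow> real ^ 'm \<Rightarrow> real ^ 'd \<Rightarrow> real"

type_synonym ('m, 'd) joint = "(real ^ 'm) \<times> (real ^ 'd) \<times> (real ^ 'm)"

abbreviation states :: "('m::finite, 'd::finite, 'n::finite) ssm \<Rightarrow> (real ^ 'm) set" where
  "states M \<equiv> cart (state_factor M)"

abbreviation params :: "('m::finite, 'd::finite, 'n::finite) ssm \<Rightarrow> (real ^ 'd) set" where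
  "params M \<equiv> cart (param_factor M)"

abbreviation data_space :: "('m::finite, 'd::finite, 'n::finite) ssm \<Rightarrow> (real ^ 'n) set" where
  "data_space M \<equiv> cart (data_factor M)"

abbreviation joint_space ::
    "('m::finite, 'd::finite, 'n::finite) ssm \<Rightarrow> ('m, 'd) joint set" where
  "joint_space M \<equiv> states M \<times> params M \<times> states M"

definition state_space_model :: "('m::finite, 'd::finite, 'n::finite) ssm \<Rightarrow> bool" where
  "state_space_model M \<longleftrightarrow>
     (\<forall>i. state_factor M i \<in> sets borel) \<and>
     (\<forall>i. param_factor M i \<in> sets borel) \<and>
     prob_density_on (params M) (prior_param M) \<and>
     (\<lambda>(x, \<theta>). prior_state M x \<theta>) \<in> borel_measurable (lborel_on (states M \<times> params M)) \<and>
     (\<forall>\<theta>\<in>params M. prob_density_on (states M) (\<lambda>x. prior_state M x \<theta>)) \<and>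
     (\<lambda>(x', \<theta>, x). transition M x' x \<theta>) \<in> borel_measurable (lborel_on (joint_space M)) \<and>
     (\<forall>x\<in>states M. \<forall>\<theta>\<in>params M. prob_density_on (states M) (\<lambda>x'. transition M x' x \<theta>)) \<and>
     (\<forall>y\<in>data_space M.
        (\<lambda>(x, \<theta>). lik M y x \<theta>) \<in> borel_measurable (lborel_on (states M \<times> params M)) \<and>
        (\<forall>x\<in>states M. \<forall>\<theta>\<in>params M. 0 \<le> lik M y x \<theta>))"

definition prior :: "('m::finite, 'd::finite, 'n::finite) ssm \<Rightarrow> (real ^ 'm) \<times> (real ^ 'd) \<Rightarrow> real" where
  "prior M = (\<lambda>(x, \<theta>). prior_param M \<theta> * prior_state M x \<theta>)"

text \<open>Arguments of joint densities are ordered \<open>(x\<^sub>t, \<theta>, x\<^sub>t\<^sub>-\<^sub>1)\<close>; the marginal integrates out the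
  last one. For integrable \<open>u\<close> the integral diverges, and is then \<open>0\<close>, only on a null set.\<close>

definition marginal ::
    "('m::finite, 'd::finite, 'n::finite) ssm \<Rightarrow>
     (('m, 'd) joint \<Rightarrow> real) \<Rightarrow> (real ^ 'm) \<times> (real ^ 'd) \<Rightarrow> real" where
  "marginal M u = (\<lambda>(x, \<theta>). \<integral>x'. u (x, \<theta>, x') \<partial>lborel_on (states M))"

definition update ::
    "('m::finite, 'd::finite, 'n::finite) ssm \<Rightarrow> (real ^ 'n) \<Rightarrow> ((real ^ 'm) \<times> (real ^ 'd) \<Rightarrow> real) \<Rightarrow>
     ('m, 'd) joint \<Rightarrow> real" where
  "update M y v = (\<lambda>(x, \<theta>, x'). v (x', \<theta>) * transition M x x' \<theta> * lik M y x \<theta>)"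

text \<open>The sequence \<open>\<pi>\<^sub>t\<close> starts at \<open>t = 1\<close>; its value at \<open>t = 0\<close> is a dummy that is never used.\<close>

primrec posterior ::
    "('m::finite, 'd::finite, 'n::finite) ssm \<Rightarrow> (nat \<Rightarrow> real ^ 'n) \<Rightarrow> nat \<Rightarrow>
     ('m, 'd) joint \<Rightarrow> real" where
  "posterior M y 0 = (\<lambda>_. 0)"
| "posterior M y (Suc t) =
     update M (y (Suc t)) (if t = 0 then prior M else marginal M (posterior M y t))"

definition evidence ::
    "('m::finite, 'd::finite, 'n::finite) ssm \<Rightarrow> (nat \<Rightarrow> real ^ 'n) \<Rightarrow> nat \<Rightarrow> real" where
  "evidence M y t = (\<integral>z. posterior M y t z \<partial>lborel_on (joint_space M))"

text \<open>\<open>approx_target M y u t\<close> is \<open>q\<^sub>t\<close>, where \<open>u\<close> is the sequence of approximations to \<open>\<pi>\<close>;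
  only \<open>u (t - 1)\<close> matters, and only if \<open>t \<ge> 2\<close>.\<close>

definition approx_target ::
    "('m::finite, 'd::finite, 'n::finite) ssm \<Rightarrow> (nat \<Rightarrow> real ^ 'n) \<Rightarrow>
     (nat \<Rightarrow> ('m, 'd) joint \<Rightarrow> real) \<Rightarrow> nat \<Rightarrow>
     ('m, 'd) joint \<Rightarrow> real" where
  "approx_target M y u t =
     update M (y t) (if t = 1 then prior M else marginal M (u (t - 1)))"

definition bound_g ::
    "('m::finite, 'd::finite, 'n::finite) ssm \<Rightarrow> (nat \<Rightarrow> real ^ 'n) \<Rightarrow> nat \<Rightarrow> ennreal" where
  "bound_g M y t = (SUP (x, \<theta>) \<in> states M \<times> params M. ennreal (lik M (y t) x \<theta>))"

definition bound_f ::
    "('m::finite, 'd::finite, 'n::finite) ssm \<Rightarrow> (nat \<Rightarrow> real ^ 'n) \<Rightarrow> nat \<Rightarrow> ennreal" where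
  "bound_f M y t =
     (SUP (x', \<theta>) \<in> states M \<times> params M.
        \<integral>\<^sup>+x. ennreal (transition M x x' \<theta> * lik M (y t) x \<theta>) \<partial>lborel_on (states M))"

section \<open>Squared tensor-train approximation\<close>

text \<open>A linear order on the index types fixes the order of the scalar coordinates.\<close>

definition coord_list :: "real ^ 'i::{finite,linorder} \<Rightarrow> real list" where
  "coord_list x = map (\<lambda>i. x $ i) (sorted_list_of_set UNIV)"

definition joint_coords ::
    "('m::{finite,linorder}, 'd::{finite,linorder}) joint \<Rightarrow> real list" where
  "joint_coords = (\<lambda>(x, \<theta>, x'). coord_list x @ coord_list \<theta> @ coord_list x')"

definition tensor_train_on ::
    "('m::{finite,linorder}, 'd::{finite,linorder}) joint set \<Rightarrow>
     (('m, 'd) joint \<Rightarrow> real) \<Rightarrow> bool" where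
  "tensor_train_on S \<phi> \<longleftrightarrow>
     (let N = 2 * CARD('m) + CARD('d) in
      \<exists>(r :: nat \<Rightarrow> nat) (H :: nat \<Rightarrow> real \<Rightarrow> real mat).
        r 0 = 1 \<and> r N = 1 \<and>
        (\<forall>k<N. \<forall>s. H k s \<in> carrier_mat (r k) (r (Suc k))) \<and>
        (\<forall>z\<in>S. \<phi> z =
           foldr (\<lambda>A B. A * B) (map (\<lambda>k. H k (joint_coords z ! k)) [0..<N]) (1\<^sub>m 1) $$ (0, 0)))"

text \<open>The three blocks may carry different families of univariate densities.\<close>

definition reference_density ::
    "('m::finite, 'd::finite, 'n::finite) ssm \<Rightarrow>
     (('m, 'd) joint \<Rightarrow> real) \<Rightarrow> bool" where
  "reference_density M \<rho> \<longleftrightarrow>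
     (\<exists>a b c.
        (\<forall>i. prob_density_on (state_factor M i) (a i)) \<and>
        (\<forall>j. prob_density_on (param_factor M j) (b j)) \<and>
        (\<forall>i. prob_density_on (state_factor M i) (c i)) \<and>
        (\<forall>x\<in>states M. \<forall>\<theta>\<in>params M. \<forall>x'\<in>states M.
           \<rho> (x, \<theta>, x') =
             (\<Prod>i\<in>UNIV. a i (x $ i)) * (\<Prod>j\<in>UNIV. b j (\<theta> $ j)) * (\<Prod>i\<in>UNIV. c i (x' $ i))))"

definition tt_approx ::
    "('z \<Rightarrow> real) \<Rightarrow> (nat \<Rightarrow> 'z \<Rightarrow> real) \<Rightarrow> (nat \<Rightarrow> real) \<Rightarrow> nat \<Rightarrow> 'z \<Rightarrow> real" where
  "tt_approx \<rho> \<phi> \<tau> t = (\<lambda>z. (\<phi> t z)\<^sup>2 + \<tau> t * \<rho> z)"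

text \<open>Boundedness of \<open>q\<^sub>t / \<rho>\<close> is stated without division, since \<open>a / 0 = 0\<close> would hide points
  with \<open>\<rho> = 0 < q\<^sub>t\<close>.\<close>

definition tt_step ::
    "('m::{finite,linorder}, 'd::{finite,linorder}, 'n::finite) ssm \<Rightarrow> (nat \<Rightarrow> real ^ 'n) \<Rightarrow>
     (('m, 'd) joint \<Rightarrow> real) \<Rightarrow>
     (nat \<Rightarrow> ('m, 'd) joint \<Rightarrow> real) \<Rightarrow> (nat \<Rightarrow> real) \<Rightarrow> nat \<Rightarrow> bool" where
  "tt_step M y \<rho> \<phi> \<tau> t \<longleftrightarrow>
     (let q = approx_target M y (tt_approx \<rho> \<phi> \<tau>) t in
        tensor_train_on (joint_space M) (\<phi> t) \<and>
        \<phi> t \<in> borel_measurable (lborel_on (joint_space M)) \<and>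
        integrable (lborel_on (joint_space M)) (\<lambda>z. (\<phi> t z)\<^sup>2) \<and>
        (\<exists>B. \<forall>z\<in>joint_space M. q z \<le> B * \<rho> z) \<and>
        0 < \<tau> t \<and>
        ennreal (\<tau> t) \<le> (L2_norm_on (joint_space M) (\<lambda>z. \<phi> t z - sqrt (q z)))\<^sup>2)"

text \<open>The times under consideration: \<open>1, \<dots>, T\<close>, or all \<open>t \<ge> 1\<close> if \<open>T = \<infinity>\<close>.\<close>

definition times_upto :: "enat \<Rightarrow> nat set" where
  "times_upto T = {t. 1 \<le> t \<and> enat t \<le> T}"

end

theory Submission
  imports Defs
begin

text \<open>Write \<open>e\<^sub>t\<close> for the \<open>L\<^sup>2\<close> distance of the square roots of \<open>tt_approx \<rho> \<phi> \<tau> t\<close> and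
  \<open>posterior M y t\<close>. Passing to marginals does not increase the \<open>L\<^sup>2\<close> distance of square roots, and
  the update with \<open>f g\<close> increases it at most by the factor \<open>sqrt (bound_f M y t)\<close>, where
  \<open>bound_f \<le> bound_g\<close> because \<open>f\<close> integrates to \<open>1\<close>. Hence \<open>e\<^sub>t \<le> \<epsilon>\<^sub>t + sqrt C * e\<^sub>t\<^sub>-\<^sub>1\<close>, and \<open>e\<^sub>1 \<le> \<epsilon>\<^sub>1\<close>
  since no approximation is made at time \<open>0\<close>. Normalizing changes the norms of the square roots by
  at most \<open>e\<^sub>t\<close>, which costs a factor \<open>2\<close>; with the factor \<open>sqrt (1/2)\<close> of the Hellinger distance this
  gives the constant \<open>sqrt 2\<close>.\<close>

section \<open>Extended square roots and the triangle inequality in L2\<close>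

lemma ennsqrt_square [simp]: "(ennsqrt a)\<^sup>2 = a"
  by (cases a) (auto simp: ennsqrt_def ennreal_power)

text \<open>Squaring is injective on \<open>ennreal\<close>, so an identity for
  \<open>ennsqrt\<close> can be checked after squaring.\<close>

lemma ennsqrt_unique: "b\<^sup>2 = a \<Longrightarrow> ennsqrt a = b"
  by (cases b) (auto simp: ennsqrt_def power2_eq_square ennreal_mult[symmetric])

lemma ennsqrt_mono: "a \<le> b \<Longrightarrow> ennsqrt a \<le> ennsqrt b"
  by (cases a; cases b) (auto simp: ennsqrt_def top_unique)

lemma ennsqrt_mult: "ennsqrt (a * b) = ennsqrt a * ennsqrt b"
  by (rule ennsqrt_unique) (simp add: power_mult_distrib)

lemma ennsqrt_ennreal: "0 \<le> x \<Longrightarrow> ennsqrt (ennreal x) = ennreal (sqrt x)"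
  by (simp add: ennsqrt_def)

lemma L2_norm_on_le_iff:
  assumes "0 \<le> a"
  shows "L2_norm_on S u \<le> ennreal a \<longleftrightarrow>
    (\<integral>\<^sup>+z. ennreal ((u z)\<^sup>2) \<partial>lborel_on S) \<le> ennreal (a\<^sup>2)"
proof -
  have "ennsqrt (ennreal (a\<^sup>2)) = ennreal a"
    using assms by (simp add: ennsqrt_ennreal)
  moreover have "ennreal (a\<^sup>2) = (ennreal a)\<^sup>2"
    using assms by (simp add: ennreal_power)
  ultimately show ?thesis
    unfolding L2_norm_on_def
    by (metis ennsqrt_mono ennsqrt_square power_mono zero_le)
qed

lemma L2_norm_on_cong:
  "(\<And>z. z \<in> S \<Longrightarrow> u z = v z) \<Longrightarrow> L2_norm_on S u = L2_norm_on S v"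
  unfolding L2_norm_on_def
  by (intro arg_cong[of _ _ ennsqrt] nn_integral_cong) (simp add: space_restrict_space)

lemma L2_norm_on_scale:
  assumes [measurable]: "u \<in> borel_measurable (lborel_on S)"
  shows "L2_norm_on S (\<lambda>z. c * u z) = ennreal \<bar>c\<bar> * L2_norm_on S u"
  unfolding L2_norm_on_def
  by (simp add: power_mult_distrib ennreal_mult nn_integral_cmult ennsqrt_mult ennsqrt_ennreal)

lemma L2_norm_on_minus_commute:
  "L2_norm_on S (\<lambda>z. u z - v z) = L2_norm_on S (\<lambda>z. v z - u z)"
  by (simp add: L2_norm_on_def power2_commute)

text \<open>The difference of the two sides is the perfect square
  \<open>(b * p - a * q)\<^sup>2\<close> divided by \<open>a * b\<close>. Integrated pointwise, this
  weighted form takes the place of the Cauchy-Schwarz inequality for integrals.\<close>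

lemma square_add_le_weighted:
  fixes a b p q :: real
  assumes "0 < a" "0 < b"
  shows "(p + q)\<^sup>2 \<le> (a + b) / a * p\<^sup>2 + (a + b) / b * q\<^sup>2"
proof -
  have "(a + b) / a * p\<^sup>2 + (a + b) / b * q\<^sup>2 - (p + q)\<^sup>2 = (b * p - a * q)\<^sup>2 / (a * b)"
    using assms by (simp add: field_simps power2_eq_square)
  also have "\<dots> \<ge> 0"
    using assms by simp
  finally show ?thesis by simp
qed

text \<open>With the norm bounds themselves as weights, the bound from the weighted inequality adds
  up to exactly \<open>(a + b)\<^sup>2\<close>. The weights occur as divisors and hence must be
  positive.\<close>

lemma L2_norm_on_triangle_real:
  assumes [measurable]: "u \<in> borel_measurable (lborel_on S)" "v \<in> borel_measurable (lborel_on S)"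
    and ab: "0 < a" "0 < b"
    and u: "L2_norm_on S u \<le> ennreal a" and v: "L2_norm_on S v \<le> ennreal b"
  shows "L2_norm_on S (\<lambda>z. u z + v z) \<le> ennreal (a + b)"
proof -
  let ?M = "lborel_on S"
  have "(\<integral>\<^sup>+z. ennreal ((u z + v z)\<^sup>2) \<partial>?M)
      \<le> (\<integral>\<^sup>+z. ennreal ((a + b) / a) * ennreal ((u z)\<^sup>2)
             + ennreal ((a + b) / b) * ennreal ((v z)\<^sup>2) \<partial>?M)"
    using ab square_add_le_weighted[OF ab]
    by (intro nn_integral_mono)
       (simp add: ennreal_mult[symmetric] ennreal_plus[symmetric] ennreal_leI del: ennreal_plus)
  also have "\<dots> = ennreal ((a + b) / a) * (\<integral>\<^sup>+z. ennreal ((u z)\<^sup>2) \<partial>?M)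
      + ennreal ((a + b) / b) * (\<integral>\<^sup>+z. ennreal ((v z)\<^sup>2) \<partial>?M)"
    by (simp add: nn_integral_add nn_integral_cmult)
  also have "\<dots> \<le> ennreal ((a + b) / a) * ennreal (a\<^sup>2) + ennreal ((a + b) / b) * ennreal (b\<^sup>2)"
    using u v ab by (intro add_mono mult_left_mono) (auto simp: L2_norm_on_le_iff)
  also have "\<dots> = ennreal ((a + b)\<^sup>2)"
  proof -
    have "(a + b) / a * a\<^sup>2 + (a + b) / b * b\<^sup>2 = (a + b)\<^sup>2"
      using ab by (simp add: field_simps power2_eq_square)
    then show ?thesis
      using ab by (simp add: ennreal_mult[symmetric] ennreal_plus[symmetric] del: ennreal_plus)
  qed
  finally show ?thesis
    using ab by (simp add: L2_norm_on_le_iff del: ennreal_plus)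
qed

lemma L2_norm_on_triangle:
  assumes "u \<in> borel_measurable (lborel_on S)" "v \<in> borel_measurable (lborel_on S)"
  shows "L2_norm_on S (\<lambda>z. u z + v z) \<le> L2_norm_on S u + L2_norm_on S v"
proof (rule ennreal_le_epsilon)
  fix e :: real
  assume "L2_norm_on S u + L2_norm_on S v < top_class.top" and e: "0 < e"
  then have "L2_norm_on S u < top_class.top" "L2_norm_on S v < top_class.top"
    by simp_all
  then obtain a b where a: "L2_norm_on S u = ennreal a" "0 \<le> a"
    and b: "L2_norm_on S v = ennreal b" "0 \<le> b"
    by (metis ennreal_cases less_irrefl)
  \<comment> \<open>Either norm may be \<open>0\<close>, so each is enlarged by \<open>e / 2\<close>
    to obtain positive bounds; the slack is absorbed by \<open>ennreal_le_epsilon\<close>.\<close>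
  have "L2_norm_on S (\<lambda>z. u z + v z) \<le> ennreal ((a + e / 2) + (b + e / 2))"
    using assms a b e by (intro L2_norm_on_triangle_real) (auto simp del: ennreal_plus)
  also have "\<dots> = ennreal a + ennreal b + ennreal e"
    using a b e by (simp add: ennreal_plus[symmetric] del: ennreal_plus)
  finally show "L2_norm_on S (\<lambda>z. u z + v z) \<le> L2_norm_on S u + L2_norm_on S v + ennreal e"
    by (simp add: a b)
qed

section \<open>Square roots of integrals as L2 norms\<close>

lemma integral_lborel_on_nonneg:
  fixes u :: "_ \<Rightarrow> real"
  shows "(\<And>z. z \<in> S \<Longrightarrow> 0 \<le> u z) \<Longrightarrow> 0 \<le> (\<integral>z. u z \<partial>lborel_on S)"
  by (rule Bochner_Integration.integral_nonneg) (simp add: space_restrict_space)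

text \<open>Squaring undoes the root on \<open>S\<close>, and integrability identifies the extended
  integral with the Bochner integral that occurs in \<open>marginal\<close>, \<open>evidence\<close>
  and \<open>normalized_on\<close>.\<close>

lemma L2_norm_on_sqrt:
  assumes "integrable (lborel_on S) u" "\<And>z. z \<in> S \<Longrightarrow> 0 \<le> u z"
  shows "L2_norm_on S (\<lambda>z. sqrt (u z)) = ennreal (sqrt (\<integral>z. u z \<partial>lborel_on S))"
proof -
  have "(\<integral>\<^sup>+z. ennreal ((sqrt (u z))\<^sup>2) \<partial>lborel_on S) = (\<integral>\<^sup>+z. ennreal (u z) \<partial>lborel_on S)"
    using assms(2) by (intro nn_integral_cong) (simp add: space_restrict_space)
  also have "\<dots> = ennreal (\<integral>z. u z \<partial>lborel_on S)"
    using assms by (intro nn_integral_eq_integral AE_I2) (auto simp: space_restrict_space)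
  finally show ?thesis
    using integral_lborel_on_nonneg[of S u] assms(2) by (simp add: L2_norm_on_def ennsqrt_ennreal)
qed

lemma integrable_if_L2_norm_on_sqrt:
  assumes "u \<in> borel_measurable (lborel_on S)" "\<And>z. z \<in> S \<Longrightarrow> 0 \<le> u z"
    and "L2_norm_on S (\<lambda>z. sqrt (u z)) < \<infinity>"
  shows "integrable (lborel_on S) u"
proof (rule integrableI_bounded)
  have "(\<integral>\<^sup>+z. ennreal (norm (u z)) \<partial>lborel_on S) = (\<integral>\<^sup>+z. ennreal ((sqrt (u z))\<^sup>2) \<partial>lborel_on S)"
    using assms(2) by (intro nn_integral_cong) (simp add: space_restrict_space)
  also have "\<dots> < \<infinity>"
    using assms(3) unfolding L2_norm_on_def ennsqrt_def by (auto simp: less_top split: if_splits)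
  finally show "(\<integral>\<^sup>+z. ennreal (norm (u z)) \<partial>lborel_on S) < \<infinity>" .
qed fact

text \<open>Writing \<open>sqrt u\<close> as \<open>(sqrt u - sqrt v) + sqrt v\<close>, the triangle
  inequality bounds its norm by two finite terms. In this way an approximation inherits
  integrability from the exact posterior once their distance is finite.\<close>

lemma integrable_if_L2_norm_on_diff:
  assumes [measurable]: "u \<in> borel_measurable (lborel_on S)"
    and u: "\<And>z. z \<in> S \<Longrightarrow> 0 \<le> u z"
    and v: "integrable (lborel_on S) v" "\<And>z. z \<in> S \<Longrightarrow> 0 \<le> v z"
    and fin: "L2_norm_on S (\<lambda>z. sqrt (u z) - sqrt (v z)) < \<infinity>"
  shows "integrable (lborel_on S) u"
proof (rule integrable_if_L2_norm_on_sqrt)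
  have [measurable]: "v \<in> borel_measurable (lborel_on S)"
    using v by auto
  have "L2_norm_on S (\<lambda>z. sqrt (u z))
      \<le> L2_norm_on S (\<lambda>z. sqrt (u z) - sqrt (v z)) + L2_norm_on S (\<lambda>z. sqrt (v z))"
    using L2_norm_on_triangle[of "\<lambda>z. sqrt (u z) - sqrt (v z)" S "\<lambda>z. sqrt (v z)"] by simp
  also have "\<dots> < \<infinity>"
    using fin by (simp add: L2_norm_on_sqrt[OF v])
  finally show "L2_norm_on S (\<lambda>z. sqrt (u z)) < \<infinity>" .
qed (use u in auto)

text \<open>The square roots of the integrals are the L2 norms of \<open>sqrt u\<close> and
  \<open>sqrt v\<close>, so this is one half of the reverse triangle inequality.\<close>

lemma sqrt_integral_le:
  assumes "integrable (lborel_on S) u" "\<And>z. z \<in> S \<Longrightarrow> 0 \<le> u z"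
    and "integrable (lborel_on S) v" "\<And>z. z \<in> S \<Longrightarrow> 0 \<le> v z"
    and "L2_norm_on S (\<lambda>z. sqrt (u z) - sqrt (v z)) \<le> ennreal d" "0 \<le> d"
  shows "sqrt (\<integral>z. u z \<partial>lborel_on S) \<le> sqrt (\<integral>z. v z \<partial>lborel_on S) + d"
proof -
  have [measurable]: "u \<in> borel_measurable (lborel_on S)" "v \<in> borel_measurable (lborel_on S)"
    using assms by auto
  have "ennreal (sqrt (\<integral>z. u z \<partial>lborel_on S)) = L2_norm_on S (\<lambda>z. sqrt (u z))"
    using assms by (simp add: L2_norm_on_sqrt)
  also have "\<dots> \<le> L2_norm_on S (\<lambda>z. sqrt (u z) - sqrt (v z)) + L2_norm_on S (\<lambda>z. sqrt (v z))"
    using L2_norm_on_triangle[of "\<lambda>z. sqrt (u z) - sqrt (v z)" S "\<lambda>z. sqrt (v z)"] by simp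
  also have "\<dots> \<le> ennreal d + ennreal (sqrt (\<integral>z. v z \<partial>lborel_on S))"
    using assms by (intro add_mono) (simp_all add: L2_norm_on_sqrt)
  finally show ?thesis
    using assms(6) integral_lborel_on_nonneg[of S v] assms(4)
    by (simp add: ennreal_plus[symmetric] add.commute del: ennreal_plus)
qed

text \<open>No integrability is needed: if the right-hand side is finite, then \<open>u\<close> and \<open>v\<close> are either
  both integrable or both not, and in the latter case both integrals are \<open>0\<close> by convention.\<close>

lemma sqrt_integral_diff_le:
  assumes meas: "u \<in> borel_measurable (lborel_on S)" "v \<in> borel_measurable (lborel_on S)"
    and nonneg: "\<And>z. z \<in> S \<Longrightarrow> 0 \<le> u z" "\<And>z. z \<in> S \<Longrightarrow> 0 \<le> v z"
  shows "ennreal \<bar>sqrt (\<integral>z. u z \<partial>lborel_on S) - sqrt (\<integral>z. v z \<partial>lborel_on S)\<bar>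
    \<le> L2_norm_on S (\<lambda>z. sqrt (u z) - sqrt (v z))"
proof (cases "L2_norm_on S (\<lambda>z. sqrt (u z) - sqrt (v z))")
  case (real d)
  \<comment> \<open>The distance is symmetric, so the converse implication and the converse
    one-sided estimate come from the same lemmas with \<open>u\<close> and \<open>v\<close>
    exchanged.\<close>
  have flip: "L2_norm_on S (\<lambda>z. sqrt (v z) - sqrt (u z)) = ennreal d"
    using real by (subst L2_norm_on_minus_commute) simp
  have int: "integrable (lborel_on S) u \<longleftrightarrow> integrable (lborel_on S) v"
  proof
    assume "integrable (lborel_on S) u"
    then show "integrable (lborel_on S) v"
      using meas(2) nonneg flip by (intro integrable_if_L2_norm_on_diff[of v S u]) simp_all
  next
    assume "integrable (lborel_on S) v"
    then show "integrable (lborel_on S) u"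
      using meas(1) nonneg real by (intro integrable_if_L2_norm_on_diff[of u S v]) simp_all
  qed
  show ?thesis
  proof (cases "integrable (lborel_on S) u")
    case True
    then have "sqrt (\<integral>z. u z \<partial>lborel_on S) \<le> sqrt (\<integral>z. v z \<partial>lborel_on S) + d"
      "sqrt (\<integral>z. v z \<partial>lborel_on S) \<le> sqrt (\<integral>z. u z \<partial>lborel_on S) + d"
      using nonneg real flip int by (intro sqrt_integral_le; simp)+
    then show ?thesis
      using real by (simp add: ennreal_leI abs_le_iff)
  next
    case False
    then show ?thesis
      using int by (simp add: not_integrable_integral_eq)
  qed
qed simp

section \<open>Hellinger distance after normalization\<close>

text \<open>The change of the function and the change of the normalizing constant each contribute at
  most \<open>d / B\<close>, the latter because the norms \<open>A\<close> and \<open>B\<close> of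
  the two square roots differ by at most their distance \<open>d\<close>.\<close>

lemma hellinger_on_normalized_le:
  assumes [measurable]: "u \<in> borel_measurable (lborel_on S)"
    and u: "\<And>z. z \<in> S \<Longrightarrow> 0 \<le> u z"
    and v: "integrable (lborel_on S) v" "\<And>z. z \<in> S \<Longrightarrow> 0 \<le> v z"
    and pos: "0 < (\<integral>z. v z \<partial>lborel_on S)"
  shows "hellinger_on S (normalized_on S u) (normalized_on S v)
    \<le> ennreal (sqrt 2 / sqrt (\<integral>z. v z \<partial>lborel_on S)) * L2_norm_on S (\<lambda>z. sqrt (u z) - sqrt (v z))"
proof (cases "L2_norm_on S (\<lambda>z. sqrt (u z) - sqrt (v z))")
  case (real d)
  define A where "A = sqrt (\<integral>z. u z \<partial>lborel_on S)"
  define B where "B = sqrt (\<integral>z. v z \<partial>lborel_on S)"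
  have [measurable]: "v \<in> borel_measurable (lborel_on S)"
    using v by auto
  have B: "0 < B"
    using pos by (simp add: B_def)
  have A: "0 \<le> A"
    using integral_lborel_on_nonneg[of S u] u by (simp add: A_def)
  have int: "integrable (lborel_on S) u"
    using u v real by (intro integrable_if_L2_norm_on_diff[of u S v]) simp_all
  have AB: "\<bar>A - B\<bar> \<le> d"
  proof -
    have "ennreal \<bar>A - B\<bar> \<le> ennreal d"
      unfolding A_def B_def real(2)[symmetric] using u v by (intro sqrt_integral_diff_le) simp_all
    then show ?thesis
      using real by simp
  qed
  \<comment> \<open>The second term is made to carry \<open>sqrt u\<close>, whose norm is
    \<open>A\<close>: for \<open>A > 0\<close> the product of \<open>A\<close> with the difference
    of reciprocals collapses to \<open>(B - A) / B\<close>. The splitting also holds for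
    \<open>A = 0\<close>, where division by zero makes the normalized \<open>u\<close>
    vanish.\<close>
  have "L2_norm_on S (\<lambda>z. sqrt (normalized_on S u z) - sqrt (normalized_on S v z))
      = L2_norm_on S (\<lambda>z. 1 / B * (sqrt (u z) - sqrt (v z)) + (1 / A - 1 / B) * sqrt (u z))"
    by (intro L2_norm_on_cong)
       (simp add: normalized_on_def real_sqrt_divide A_def[symmetric] B_def[symmetric]
          left_diff_distrib right_diff_distrib)
  also have "\<dots> \<le> ennreal \<bar>1 / B\<bar> * L2_norm_on S (\<lambda>z. sqrt (u z) - sqrt (v z))
      + ennreal \<bar>1 / A - 1 / B\<bar> * L2_norm_on S (\<lambda>z. sqrt (u z))"
    by (rule order_trans[OF L2_norm_on_triangle], measurable, intro add_mono eq_refl L2_norm_on_scale)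
       measurable
  also have "\<dots> = ennreal (1 / B * d + \<bar>1 / A - 1 / B\<bar> * A)"
    using A B real
    by (simp add: L2_norm_on_sqrt[OF int u] A_def[symmetric] ennreal_mult[symmetric])
  also have "\<dots> \<le> ennreal (2 * (d / B))"
  proof (rule ennreal_leI)
    have "\<bar>1 / A - 1 / B\<bar> * A \<le> d / B"
    proof (cases "A = 0")
      case False
      then have "\<bar>1 / A - 1 / B\<bar> * A = \<bar>(1 / A - 1 / B) * A\<bar>"
        using A by (simp add: abs_mult)
      also have "(1 / A - 1 / B) * A = - (A - B) / B"
        using B False by (simp add: field_simps)
      also have "\<bar>\<dots>\<bar> = \<bar>A - B\<bar> / B"
        using B by simp
      also have "\<dots> \<le> d / B"
        using AB B by (simp add: divide_right_mono)
      finally show ?thesis .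
    qed (use real B in simp)
    then show "1 / B * d + \<bar>1 / A - 1 / B\<bar> * A \<le> 2 * (d / B)"
      by simp
  qed
  \<comment> \<open>\<open>ennsqrt_mult\<close> pulls the factor \<open>1 / 2\<close> out of the
    Hellinger distance as \<open>sqrt (1 / 2)\<close>, which turns the constant \<open>2\<close>
    into \<open>sqrt 2\<close>.\<close>
  finally have "hellinger_on S (normalized_on S u) (normalized_on S v)
      \<le> ennreal (sqrt (1 / 2)) * ennreal (2 * (d / B))"
    unfolding hellinger_on_def L2_norm_on_def ennsqrt_mult
    by (subst ennsqrt_ennreal, simp) (rule mult_left_mono, simp_all)
  also have "\<dots> = ennreal (sqrt 2 / B * d)"
  proof -
    have "sqrt (1 / 2) * 2 = sqrt 2"
      by (simp add: real_sqrt_divide real_div_sqrt)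
    then have "sqrt (1 / 2) * (2 * (d / B)) = sqrt 2 / B * d"
      by (metis (no_types, lifting) mult.assoc times_divide_eq_left times_divide_eq_right)
    then show ?thesis
      using B real by (simp add: ennreal_mult[symmetric] del: real_sqrt_divide)
  qed
  finally show ?thesis
    unfolding B_def[symmetric] real(2) using B real(1)
    by (subst ennreal_mult[symmetric]) simp_all
\<comment> \<open>At infinite distance the right-hand side is infinite, since its constant is
  positive.\<close>
qed (use pos in \<open>simp add: ennreal_mult_top\<close>)

section \<open>Lebesgue measure on products of Borel sets\<close>

lemma sigma_finite_lborel_on:
  "A \<in> sets borel \<Longrightarrow> sigma_finite_measure (lborel_on A)"
  by (auto intro!: sigma_finite_measure_restrict_space lborel.sigma_finite_measure_axioms)

text \<open>Makes Tonelli's theorem available on the restricted domains. By uniqueness of product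
  measures it suffices that the sigma-algebras agree and that rectangles have the right
  measure.\<close>

lemma lborel_on_Times:
  fixes A :: "'a::euclidean_space set" and B :: "'b::euclidean_space set"
  assumes "A \<in> sets borel" "B \<in> sets borel"
  shows "lborel_on (A \<times> B) = lborel_on A \<Otimes>\<^sub>M lborel_on B"
proof (rule pair_measure_eqI[symmetric])
  show "sigma_finite_measure (lborel_on A)" "sigma_finite_measure (lborel_on B)"
    using assms by (simp_all add: sigma_finite_lborel_on)
  have AB: "A \<times> B \<in> sets (lborel :: ('a \<times> 'b) measure)"
    using assms by (simp add: borel_prod[symmetric])
  show "sets (lborel_on A \<Otimes>\<^sub>M lborel_on B) = sets (lborel_on (A \<times> B))"
  proof
    \<comment> \<open>Measurability of the identity in this direction gives one inclusion of the
      sigma-algebras; the opposite direction below gives the other.\<close>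
    have "(\<lambda>z. z) \<in> lborel_on (A \<times> B) \<rightarrow>\<^sub>M lborel_on A \<Otimes>\<^sub>M lborel_on B"
    proof (rule measurable_pair; rule measurable_restrict_space2)
      show "fst \<circ> (\<lambda>z. z) \<in> lborel_on (A \<times> B) \<rightarrow>\<^sub>M lborel"
        "snd \<circ> (\<lambda>z. z) \<in> lborel_on (A \<times> B) \<rightarrow>\<^sub>M lborel"
        by (auto intro!: measurable_restrict_space1 borel_measurable_continuous_onI continuous_intros
            simp: o_def)
    qed (auto simp: space_restrict_space)
    from measurable_sets[OF this]
    show "sets (lborel_on A \<Otimes>\<^sub>M lborel_on B) \<subseteq> sets (lborel_on (A \<times> B))"
      using sets.sets_into_space[of _ "lborel_on A \<Otimes>\<^sub>M lborel_on B"]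
      by (fastforce simp: space_restrict_space space_pair_measure Int_absorb2)
    have "(\<lambda>z. (fst z, snd z)) \<in> lborel_on A \<Otimes>\<^sub>M lborel_on B \<rightarrow>\<^sub>M lborel \<Otimes>\<^sub>M lborel"
      by (intro measurable_Pair measurable_compose[OF measurable_fst]
          measurable_compose[OF measurable_snd] measurable_restrict_space1) simp_all
    then have "(\<lambda>z. z) \<in> lborel_on A \<Otimes>\<^sub>M lborel_on B \<rightarrow>\<^sub>M lborel_on (A \<times> B)"
      by (intro measurable_restrict_space2)
         (auto simp: space_pair_measure space_restrict_space lborel_prod)
    from measurable_sets[OF this]
    show "sets (lborel_on (A \<times> B)) \<subseteq> sets (lborel_on A \<Otimes>\<^sub>M lborel_on B)"
      using sets.sets_into_space[of _ "lborel_on (A \<times> B)"]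
      by (fastforce simp: space_restrict_space space_pair_measure Int_absorb2)
  qed
  fix C D assume "C \<in> sets (lborel_on A)" "D \<in> sets (lborel_on B)"
  then have C: "C \<in> sets lborel" "C \<subseteq> A" and D: "D \<in> sets lborel" "D \<subseteq> B"
    using assms by (auto simp: sets_restrict_space_iff)
  have "emeasure (lborel_on (A \<times> B)) (C \<times> D) = emeasure (lborel \<Otimes>\<^sub>M lborel) (C \<times> D)"
    using AB C D by (subst emeasure_restrict_space) (auto simp: lborel_prod)
  also have "\<dots> = emeasure lborel C * emeasure lborel D"
    using C D by (intro lborel.emeasure_pair_measure_Times) auto
  finally show "emeasure (lborel_on A) C * emeasure (lborel_on B) D
      = emeasure (lborel_on (A \<times> B)) (C \<times> D)"
    using assms C D by (simp add: emeasure_restrict_space)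
qed

lemma sets_borel_cart [measurable]:
  assumes "\<And>i. A i \<in> sets borel"
  shows "cart A \<in> sets borel"
proof -
  have "cart A = (\<Inter>i. (\<lambda>x. x $ i) -` A i \<inter> space borel)"
    by (auto simp: cart_def)
  also have "\<dots> \<in> sets borel"
    using assms
    by (intro sets.countable_INT' image_subsetI measurable_sets[where A = borel]
        borel_measurable_continuous_onI continuous_intros) auto
  finally show ?thesis .
qed

lemma borel_measurable_lborel_on_joint_iff:
  assumes "X \<in> sets borel" "P \<in> sets borel"
  shows "u \<in> borel_measurable (lborel_on (X \<times> P \<times> X))
    \<longleftrightarrow> u \<in> borel_measurable (lborel_on X \<Otimes>\<^sub>M (lborel_on P \<Otimes>\<^sub>M lborel_on X))"
proof -
  have "P \<times> X \<in> sets borel"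
    using assms by (simp add: borel_prod[symmetric])
  then show ?thesis
    using assms by (simp add: lborel_on_Times)
qed

section \<open>Update and marginalization in the L2 distance of square roots\<close>

text \<open>The common weight factors out of the square, leaving
  \<open>(sqrt v - sqrt w)\<^sup>2 * K\<close>, where only \<open>K\<close> depends on the new state
  \<open>x\<close>. Integrating over \<open>x\<close> first therefore costs at most the factor
  \<open>c\<close>.\<close>

lemma L2_norm_on_weighted_le:
  fixes v w :: "'a::euclidean_space \<times> 'b::euclidean_space \<Rightarrow> real"
    and K :: "'a \<times> 'b \<times> 'a \<Rightarrow> real"
  assumes X: "X \<in> sets borel" and P: "P \<in> sets borel"
    and v: "v \<in> borel_measurable (lborel_on (X \<times> P))"
    and w: "w \<in> borel_measurable (lborel_on (X \<times> P))"
    and K: "K \<in> borel_measurable (lborel_on (X \<times> P \<times> X))"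
    and nonneg: "\<And>z. z \<in> X \<times> P \<times> X \<Longrightarrow> 0 \<le> K z"
    and bound: "\<And>x' \<theta>. x' \<in> X \<Longrightarrow> \<theta> \<in> P \<Longrightarrow> (\<integral>\<^sup>+x. ennreal (K (x, \<theta>, x')) \<partial>lborel_on X) \<le> c"
  shows "L2_norm_on (X \<times> P \<times> X)
      (\<lambda>(x, \<theta>, x'). sqrt (v (x', \<theta>) * K (x, \<theta>, x')) - sqrt (w (x', \<theta>) * K (x, \<theta>, x')))
    \<le> ennsqrt c * L2_norm_on (X \<times> P) (\<lambda>z. sqrt (v z) - sqrt (w z))"
proof -
  let ?X = "lborel_on X" and ?P = "lborel_on P"
  interpret X: sigma_finite_measure ?X by (rule sigma_finite_lborel_on[OF X])
  interpret P: sigma_finite_measure ?P by (rule sigma_finite_lborel_on[OF P])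
  interpret PX: pair_sigma_finite ?P ?X ..
  interpret XPX: pair_sigma_finite ?X "?P \<Otimes>\<^sub>M ?X" ..
  have PX: "P \<times> X \<in> sets borel"
    using X P by (simp add: borel_prod[symmetric])
  have [measurable]: "v \<in> borel_measurable (?X \<Otimes>\<^sub>M ?P)" "w \<in> borel_measurable (?X \<Otimes>\<^sub>M ?P)"
    "K \<in> borel_measurable (?X \<Otimes>\<^sub>M (?P \<Otimes>\<^sub>M ?X))"
    using v w K X P PX by (simp_all add: lborel_on_Times)
  define F where "F \<theta> x' = ennreal ((sqrt (v (x', \<theta>)) - sqrt (w (x', \<theta>)))\<^sup>2)" for \<theta> x'
  have F [measurable]: "(\<lambda>(\<theta>, x'). F \<theta> x') \<in> borel_measurable (?P \<Otimes>\<^sub>M ?X)"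
    unfolding F_def by measurable
  have "(\<integral>\<^sup>+z. ennreal ((case z of (x, \<theta>, x') \<Rightarrow>
          sqrt (v (x', \<theta>) * K (x, \<theta>, x')) - sqrt (w (x', \<theta>) * K (x, \<theta>, x')))\<^sup>2) \<partial>lborel_on (X \<times> P \<times> X))
      = (\<integral>\<^sup>+(x, \<theta>, x'). F \<theta> x' * ennreal (K (x, \<theta>, x')) \<partial>(?X \<Otimes>\<^sub>M (?P \<Otimes>\<^sub>M ?X)))"
    unfolding lborel_on_Times[OF X PX, unfolded lborel_on_Times[OF P X]]
  proof (rule nn_integral_cong, clarsimp simp: space_pair_measure space_restrict_space)
    fix x \<theta> x' assume "x \<in> X" "\<theta> \<in> P" "x' \<in> X"
    then have "0 \<le> K (x, \<theta>, x')"
      by (simp add: nonneg)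
    then show "ennreal ((sqrt (v (x', \<theta>) * K (x, \<theta>, x')) - sqrt (w (x', \<theta>) * K (x, \<theta>, x')))\<^sup>2)
        = F \<theta> x' * ennreal (K (x, \<theta>, x'))"
      by (simp add: F_def real_sqrt_mult left_diff_distrib[symmetric] power_mult_distrib ennreal_mult)
  qed
  also have "\<dots> = (\<integral>\<^sup>+(\<theta>, x'). \<integral>\<^sup>+x. F \<theta> x' * ennreal (K (x, \<theta>, x')) \<partial>?X \<partial>(?P \<Otimes>\<^sub>M ?X))"
    by (subst XPX.nn_integral_snd[symmetric]) (simp_all add: split_beta')
  also have "\<dots> \<le> (\<integral>\<^sup>+(\<theta>, x'). c * F \<theta> x' \<partial>(?P \<Otimes>\<^sub>M ?X))"
  proof (rule nn_integral_mono, clarsimp simp: space_pair_measure space_restrict_space)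
    fix \<theta> x' assume "\<theta> \<in> P" "x' \<in> X"
    then have [measurable]: "\<theta> \<in> space ?P" "x' \<in> space ?X"
      by (simp_all add: space_restrict_space)
    have "(\<integral>\<^sup>+x. F \<theta> x' * ennreal (K (x, \<theta>, x')) \<partial>?X) = F \<theta> x' * (\<integral>\<^sup>+x. ennreal (K (x, \<theta>, x')) \<partial>?X)"
      by (rule nn_integral_cmult) measurable
    also have "\<dots> \<le> F \<theta> x' * c"
      using bound \<open>\<theta> \<in> P\<close> \<open>x' \<in> X\<close> by (intro mult_left_mono) auto
    finally show "(\<integral>\<^sup>+x. F \<theta> x' * ennreal (K (x, \<theta>, x')) \<partial>?X) \<le> c * F \<theta> x'"
      by (simp add: mult.commute)
  qed
  also have "\<dots> = c * (\<integral>\<^sup>+(\<theta>, x'). F \<theta> x' \<partial>(?P \<Otimes>\<^sub>M ?X))"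
    by (simp add: split_beta' nn_integral_cmult)
  \<comment> \<open>The joint space lists these variables as \<open>(\<theta>, x')\<close>, the
    domain of \<open>v\<close> and \<open>w\<close> as \<open>(x', \<theta>)\<close>; both integrals
    equal the same iterated integral.\<close>
  also have "(\<integral>\<^sup>+(\<theta>, x'). F \<theta> x' \<partial>(?P \<Otimes>\<^sub>M ?X)) = (\<integral>\<^sup>+(x', \<theta>). F \<theta> x' \<partial>(?X \<Otimes>\<^sub>M ?P))"
    using PX.nn_integral_snd[of "\<lambda>(\<theta>, x'). F \<theta> x'"]
      P.nn_integral_fst[of "\<lambda>(x', \<theta>). F \<theta> x'" ?X] by simp
  also have "\<dots> = (\<integral>\<^sup>+z. ennreal ((sqrt (v z) - sqrt (w z))\<^sup>2) \<partial>lborel_on (X \<times> P))"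
    by (simp add: lborel_on_Times[OF X P] F_def split_beta')
  finally show ?thesis
    unfolding L2_norm_on_def ennsqrt_mult[symmetric] by (rule ennsqrt_mono)
qed

text \<open>For fixed \<open>(x, \<theta>)\<close> the square root of a finite marginal is the L2
  norm of the root on the fibre, so the reverse triangle inequality compares the two marginals;
  squaring and integrating over all fibres finishes. Fibres with divergent integrals are covered by
  \<open>sqrt_integral_diff_le\<close>.\<close>

lemma L2_norm_on_marginal_le:
  fixes M :: "('m::finite, 'd::finite, 'n::finite) ssm"
  assumes X: "states M \<in> sets borel" and P: "params M \<in> sets borel"
    and u: "u \<in> borel_measurable (lborel_on (joint_space M))"
    and v: "v \<in> borel_measurable (lborel_on (joint_space M))"
    and nonneg: "\<And>z. z \<in> joint_space M \<Longrightarrow> 0 \<le> u z" "\<And>z. z \<in> joint_space M \<Longrightarrow> 0 \<le> v z"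
  shows "L2_norm_on (states M \<times> params M) (\<lambda>z. sqrt (marginal M u z) - sqrt (marginal M v z))
    \<le> L2_norm_on (joint_space M) (\<lambda>z. sqrt (u z) - sqrt (v z))"
proof -
  let ?X = "lborel_on (states M)" and ?P = "lborel_on (params M)"
  interpret X: sigma_finite_measure ?X by (rule sigma_finite_lborel_on[OF X])
  interpret P: sigma_finite_measure ?P by (rule sigma_finite_lborel_on[OF P])
  interpret PX: pair_sigma_finite ?P ?X ..
  have PX: "params M \<times> states M \<in> sets borel"
    using X P by (simp add: borel_prod[symmetric])
  have [measurable]: "u \<in> borel_measurable (?X \<Otimes>\<^sub>M (?P \<Otimes>\<^sub>M ?X))"
    "v \<in> borel_measurable (?X \<Otimes>\<^sub>M (?P \<Otimes>\<^sub>M ?X))"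
    using u v X P PX by (simp_all add: lborel_on_Times)
  let ?D = "\<lambda>z. ennreal ((sqrt (u z) - sqrt (v z))\<^sup>2)"
  have "(\<integral>\<^sup>+z. ennreal ((sqrt (marginal M u z) - sqrt (marginal M v z))\<^sup>2) \<partial>(?X \<Otimes>\<^sub>M ?P))
      \<le> (\<integral>\<^sup>+(x, \<theta>). \<integral>\<^sup>+x'. ?D (x, \<theta>, x') \<partial>?X \<partial>(?X \<Otimes>\<^sub>M ?P))"
  proof (rule nn_integral_mono, clarsimp simp: space_pair_measure space_restrict_space)
    fix x \<theta> assume x: "x \<in> states M" and \<theta>: "\<theta> \<in> params M"
    then have [measurable]: "x \<in> space ?X" "\<theta> \<in> space ?P"
      by (simp_all add: space_restrict_space)
    let ?d = "sqrt (marginal M u (x, \<theta>)) - sqrt (marginal M v (x, \<theta>))"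
    have "ennreal \<bar>?d\<bar>
        \<le> L2_norm_on (states M) (\<lambda>x'. sqrt (u (x, \<theta>, x')) - sqrt (v (x, \<theta>, x')))"
      unfolding marginal_def prod.case
      using x \<theta> nonneg by (intro sqrt_integral_diff_le) auto
    then have "(ennreal \<bar>?d\<bar>)\<^sup>2
        \<le> (L2_norm_on (states M) (\<lambda>x'. sqrt (u (x, \<theta>, x')) - sqrt (v (x, \<theta>, x'))))\<^sup>2"
      by (intro power_mono) auto
    then show "ennreal (?d\<^sup>2) \<le> (\<integral>\<^sup>+x'. ?D (x, \<theta>, x') \<partial>?X)"
      by (simp add: L2_norm_on_def ennreal_power)
  qed
  also have "\<dots> = (\<integral>\<^sup>+x. \<integral>\<^sup>+\<theta>. \<integral>\<^sup>+x'. ?D (x, \<theta>, x') \<partial>?X \<partial>?P \<partial>?X)"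
    by (subst P.nn_integral_fst[symmetric]) (simp_all add: split_beta')
  also have "\<dots> = (\<integral>\<^sup>+x. \<integral>\<^sup>+z. ?D (x, z) \<partial>(?P \<Otimes>\<^sub>M ?X) \<partial>?X)"
    by (intro nn_integral_cong X.nn_integral_fst) measurable
  also have "\<dots> = (\<integral>\<^sup>+z. ?D z \<partial>(?X \<Otimes>\<^sub>M (?P \<Otimes>\<^sub>M ?X)))"
    by (rule PX.nn_integral_fst) measurable
  finally show ?thesis
    unfolding L2_norm_on_def lborel_on_Times[OF X PX] lborel_on_Times[OF P X] lborel_on_Times[OF X P]
    by (rule ennsqrt_mono)
qed

section \<open>Measurability and nonnegativity of the exact densities\<close>

lemma times_upto_Suc:
  assumes "Suc t \<in> times_upto T" "1 \<le> t"
  shows "t \<in> times_upto T"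
proof -
  have "enat t \<le> enat (Suc t)" by simp
  then show ?thesis
    using assms unfolding times_upto_def by (auto intro: order_trans simp del: enat_ord_simps)
qed

lemma state_space_model_borel:
  assumes "state_space_model M"
  shows "states M \<in> sets borel" "params M \<in> sets borel"
  using assms by (auto simp: state_space_model_def intro!: sets_borel_cart)

lemma borel_measurable_marginal:
  assumes X: "states M \<in> sets borel" and P: "params M \<in> sets borel"
    and u: "u \<in> borel_measurable (lborel_on (joint_space M))"
  shows "marginal M u \<in> borel_measurable (lborel_on (states M \<times> params M))"
proof -
  let ?X = "lborel_on (states M)" and ?P = "lborel_on (params M)"
  interpret X: sigma_finite_measure ?X by (rule sigma_finite_lborel_on[OF X])
  have [measurable]: "u \<in> borel_measurable (?X \<Otimes>\<^sub>M (?P \<Otimes>\<^sub>M ?X))"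
    using u borel_measurable_lborel_on_joint_iff[OF X P] by blast
  show ?thesis
    unfolding lborel_on_Times[OF X P] marginal_def by measurable
qed

lemma marginal_nonneg:
  assumes "\<And>z. z \<in> joint_space M \<Longrightarrow> 0 \<le> u z" "z \<in> states M \<times> params M"
  shows "0 \<le> marginal M u z"
  using assms by (auto simp: marginal_def intro!: integral_lborel_on_nonneg)

lemma prior_nonneg:
  assumes "state_space_model M" "z \<in> states M \<times> params M"
  shows "0 \<le> prior M z"
  using assms by (auto simp: prior_def state_space_model_def prob_density_on_def)

lemma borel_measurable_prior:
  assumes M: "state_space_model M"
  shows "prior M \<in> borel_measurable (lborel_on (states M \<times> params M))"
proof -
  note XP = state_space_model_borel[OF M]
  have [measurable]: "prior_param M \<in> borel_measurable (lborel_on (params M))"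
    "(\<lambda>(x, \<theta>). prior_state M x \<theta>) \<in> borel_measurable (lborel_on (states M) \<Otimes>\<^sub>M lborel_on (params M))"
    using M XP by (auto simp: state_space_model_def prob_density_on_def lborel_on_Times)
  show ?thesis
    unfolding lborel_on_Times[OF XP] prior_def by measurable
qed

text \<open>The part of \<open>update\<close> that does not involve the incoming density; its
  integral over the new state is what \<open>bound_f\<close> bounds.\<close>

definition kernel ::
  "('m::finite, 'd::finite, 'n::finite) ssm \<Rightarrow> (real ^ 'n) \<Rightarrow> ('m, 'd) joint \<Rightarrow> real" where
  "kernel M y = (\<lambda>(x, \<theta>, x'). transition M x x' \<theta> * lik M y x \<theta>)"

lemma update_eq_kernel: "update M y v (x, \<theta>, x') = v (x', \<theta>) * kernel M y (x, \<theta>, x')"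
  by (simp add: update_def kernel_def)

lemma kernel_nonneg:
  assumes "state_space_model M" "y \<in> data_space M" "z \<in> joint_space M"
  shows "0 \<le> kernel M y z"
  using assms by (auto simp: kernel_def state_space_model_def prob_density_on_def)

lemma borel_measurable_kernel:
  assumes M: "state_space_model M" and y: "y \<in> data_space M"
  shows "kernel M y \<in> borel_measurable (lborel_on (joint_space M))"
proof -
  let ?X = "lborel_on (states M)" and ?P = "lborel_on (params M)"
  note XP = state_space_model_borel[OF M]
  define f where "f = (\<lambda>(x', \<theta>, x). transition M x' x \<theta>)"
  define g where "g = (\<lambda>(x, \<theta>). lik M y x \<theta>)"
  have "f \<in> borel_measurable (lborel_on (joint_space M))"
    "g \<in> borel_measurable (lborel_on (states M \<times> params M))"
    using M y by (auto simp: state_space_model_def f_def g_def)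
  then have [measurable]: "f \<in> borel_measurable (?X \<Otimes>\<^sub>M (?P \<Otimes>\<^sub>M ?X))" "g \<in> borel_measurable (?X \<Otimes>\<^sub>M ?P)"
    by (simp_all only: borel_measurable_lborel_on_joint_iff[OF XP] lborel_on_Times[OF XP])
  \<comment> \<open>The likelihood sees only the new state and the parameter, so \<open>g\<close> is
    composed with projections; in this form measurability on the triple product is
    automatic.\<close>
  have "kernel M y = (\<lambda>z. f z * g (fst z, fst (snd z)))"
    by (auto simp: kernel_def f_def g_def)
  then show ?thesis
    unfolding borel_measurable_lborel_on_joint_iff[OF XP] by simp
qed

lemma update_nonneg:
  assumes "state_space_model M" "y \<in> data_space M"
    and "\<And>z. z \<in> states M \<times> params M \<Longrightarrow> 0 \<le> v z" "z \<in> joint_space M"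
  shows "0 \<le> update M y v z"
  using assms kernel_nonneg[OF assms(1,2)] by (cases z) (auto simp: update_eq_kernel)

lemma borel_measurable_update:
  assumes M: "state_space_model M" and y: "y \<in> data_space M"
    and v: "v \<in> borel_measurable (lborel_on (states M \<times> params M))"
  shows "update M y v \<in> borel_measurable (lborel_on (joint_space M))"
proof -
  let ?X = "lborel_on (states M)" and ?P = "lborel_on (params M)"
  note XP = state_space_model_borel[OF M]
  have [measurable]: "v \<in> borel_measurable (?X \<Otimes>\<^sub>M ?P)"
    "kernel M y \<in> borel_measurable (?X \<Otimes>\<^sub>M (?P \<Otimes>\<^sub>M ?X))"
    using v borel_measurable_kernel[OF M y]
    by (simp_all add: borel_measurable_lborel_on_joint_iff[OF XP] lborel_on_Times[OF XP])
  have "update M y v = (\<lambda>(x, \<theta>, x'). v (x', \<theta>) * kernel M y (x, \<theta>, x'))"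
    by (auto simp: update_eq_kernel)
  then show ?thesis
    unfolding borel_measurable_lborel_on_joint_iff[OF XP] by simp
qed

lemma posterior_measurable_and_nonneg:
  assumes M: "state_space_model M" and y: "\<And>t. t \<in> times_upto T \<Longrightarrow> y t \<in> data_space M"
    and "t \<in> times_upto T"
  shows "posterior M y t \<in> borel_measurable (lborel_on (joint_space M)) \<and>
    (\<forall>z\<in>joint_space M. 0 \<le> posterior M y t z)"
  using assms(3)
proof (induction t)
  case (Suc t)
  note y' = y[OF Suc.prems]
  show ?case
  \<comment> \<open>Time 1 starts from the prior. Since \<open>0\<close> lies outside
    \<open>times_upto T\<close>, the induction hypothesis is available only for
    \<open>t \<ge> 1\<close>.\<close>
  proof (cases "t = 0")
    case True
    then show ?thesis
      using borel_measurable_update[OF M y' borel_measurable_prior[OF M]]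
        update_nonneg[OF M y' prior_nonneg[OF M]] by auto
  next
    case False
    then have "t \<in> times_upto T"
      using times_upto_Suc[OF Suc.prems] by simp
    from Suc.IH[OF this] have IH: "posterior M y t \<in> borel_measurable (lborel_on (joint_space M))"
      "\<And>z. z \<in> joint_space M \<Longrightarrow> 0 \<le> posterior M y t z"
      by auto
    show ?thesis
      using False
        borel_measurable_update[OF M y' borel_measurable_marginal[OF state_space_model_borel[OF M] IH(1)]]
        update_nonneg[OF M y', of "marginal M (posterior M y t)"] marginal_nonneg[of M "posterior M y t"] IH(2)
      by auto
  qed
qed (simp add: times_upto_def)

lemmas posterior_measurable = posterior_measurable_and_nonneg[THEN conjunct1]
lemmas posterior_nonneg = posterior_measurable_and_nonneg[THEN conjunct2, rule_format]

section \<open>One-step constants for the likelihood and the transition\<close>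

text \<open>Once the likelihood is replaced by its supremum, what remains under the integral is a
  probability density. This reduces both choices of \<open>h\<close> to the single property that
  \<open>h\<close> dominates \<open>bound_f\<close>.\<close>

lemma bound_f_le_bound_g:
  assumes M: "state_space_model M" and y: "y t \<in> data_space M"
  shows "bound_f M y t \<le> bound_g M y t"
  unfolding bound_f_def
proof (rule SUP_least, clarify)
  fix x' \<theta> assume x': "x' \<in> states M" and \<theta>: "\<theta> \<in> params M"
  let ?X = "lborel_on (states M)"
  have dens: "prob_density_on (states M) (\<lambda>x. transition M x x' \<theta>)"
    using M x' \<theta> by (simp add: state_space_model_def)
  have "(\<integral>\<^sup>+x. ennreal (transition M x x' \<theta> * lik M (y t) x \<theta>) \<partial>?X)
      \<le> (\<integral>\<^sup>+x. ennreal (transition M x x' \<theta>) * bound_g M y t \<partial>?X)"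
  proof (rule nn_integral_mono)
    fix x assume "x \<in> space ?X"
    then have x: "x \<in> states M"
      by (simp add: space_restrict_space)
    have "ennreal (lik M (y t) x \<theta>) \<le> bound_g M y t"
      unfolding bound_g_def using x \<theta> by (intro SUP_upper2[of "(x, \<theta>)"]) auto
    moreover have "0 \<le> transition M x x' \<theta>"
      using dens x by (simp add: prob_density_on_def)
    ultimately show "ennreal (transition M x x' \<theta> * lik M (y t) x \<theta>)
        \<le> ennreal (transition M x x' \<theta>) * bound_g M y t"
      by (simp add: ennreal_mult' mult_left_mono)
  qed
  also have "\<dots> = bound_g M y t"
    using dens unfolding prob_density_on_def by (subst nn_integral_multc) auto
  finally show "(\<integral>\<^sup>+x. ennreal (transition M x x' \<theta> * lik M (y t) x \<theta>) \<partial>?X) \<le> bound_g M y t" .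
qed

text \<open>Two updates with the same data share the weight \<open>kernel\<close>, so
  \<open>L2_norm_on_weighted_le\<close> applies with \<open>bound_f\<close> as the constant.\<close>

lemma L2_norm_on_update_le:
  fixes M :: "('m::finite, 'd::finite, 'n::finite) ssm"
  assumes M: "state_space_model M" and y: "y t \<in> data_space M"
    and v: "v \<in> borel_measurable (lborel_on (states M \<times> params M))"
    and w: "w \<in> borel_measurable (lborel_on (states M \<times> params M))"
  shows "L2_norm_on (joint_space M) (\<lambda>z. sqrt (update M (y t) v z) - sqrt (update M (y t) w z))
    \<le> ennsqrt (bound_f M y t) * L2_norm_on (states M \<times> params M) (\<lambda>z. sqrt (v z) - sqrt (w z))"
proof -
  note XP = state_space_model_borel[OF M]
  have "(\<integral>\<^sup>+x. ennreal (kernel M (y t) (x, \<theta>, x')) \<partial>lborel_on (states M)) \<le> bound_f M y t"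
    if "x' \<in> states M" "\<theta> \<in> params M" for x' \<theta>
    unfolding bound_f_def kernel_def using that by (intro SUP_upper2[of "(x', \<theta>)"]) auto
  note le = L2_norm_on_weighted_le[OF XP v w borel_measurable_kernel[OF M y]
      kernel_nonneg[OF M y] this]
  have "(\<lambda>z. sqrt (update M (y t) v z) - sqrt (update M (y t) w z))
      = (\<lambda>(x, \<theta>, x'). sqrt (v (x', \<theta>) * kernel M (y t) (x, \<theta>, x'))
          - sqrt (w (x', \<theta>) * kernel M (y t) (x, \<theta>, x')))"
    by (auto simp: update_eq_kernel)
  with le show ?thesis
    by simp
qed

section \<open>Reference densities\<close>

lemma reference_density_nonneg:
  assumes "reference_density M \<rho>" "z \<in> joint_space M"
  shows "0 \<le> \<rho> z"
  using assms
  by (cases z) (auto simp: reference_density_def prob_density_on_def cart_def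
      intro!: mult_nonneg_nonneg prod_nonneg)

lemma borel_measurable_reference_density:
  fixes M :: "('m::finite, 'd::finite, 'n::finite) ssm"
  assumes \<rho>: "reference_density M \<rho>"
  shows "\<rho> \<in> borel_measurable (lborel_on (joint_space M))"
proof -
  obtain a b c where
    dens: "\<And>i. prob_density_on (state_factor M i) (a i)" "\<And>j. prob_density_on (param_factor M j) (b j)"
      "\<And>i. prob_density_on (state_factor M i) (c i)"
    and eq: "\<forall>x\<in>states M. \<forall>\<theta>\<in>params M. \<forall>x'\<in>states M. \<rho> (x, \<theta>, x') =
      (\<Prod>i\<in>UNIV. a i (x $ i)) * (\<Prod>j\<in>UNIV. b j (\<theta> $ j)) * (\<Prod>i\<in>UNIV. c i (x' $ i))"
    using \<rho> unfolding reference_density_def by blast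
  let ?J = "lborel_on (joint_space M)"
  \<comment> \<open>Each factor is a univariate density composed with a coordinate map. The density
    is known to be measurable only on its factor set, so the coordinate must be shown to land
    there.\<close>
  have coord: "(\<lambda>z. u (p z)) \<in> borel_measurable ?J"
    if "prob_density_on A u" "continuous_on UNIV p" "\<And>z. z \<in> joint_space M \<Longrightarrow> p z \<in> A"
    for A and u :: "real \<Rightarrow> real" and p
  proof (rule measurable_compose[where f = p and g = u])
    show "p \<in> ?J \<rightarrow>\<^sub>M lborel_on A"
      using that by (intro measurable_restrict_space2 measurable_restrict_space1)
        (auto simp: space_restrict_space intro!: borel_measurable_continuous_onI)
    show "u \<in> borel_measurable (lborel_on A)"
      using that by (simp add: prob_density_on_def)
  qed
  have "(\<lambda>z. (\<Prod>i\<in>UNIV. a i (fst z $ i)) * (\<Prod>j\<in>UNIV. b j (fst (snd z) $ j))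
      * (\<Prod>i\<in>UNIV. c i (snd (snd z) $ i))) \<in> borel_measurable ?J"
    by (intro borel_measurable_times borel_measurable_prod coord[OF dens(1)] coord[OF dens(2)]
        coord[OF dens(3)] continuous_intros) (auto simp: cart_def)
  \<comment> \<open>The product formula determines \<open>\<rho>\<close> only on the joint space,
    which is the whole space of the restricted measure.\<close>
  also have "?this \<longleftrightarrow> ?thesis"
    using eq by (intro measurable_cong) (auto simp: space_restrict_space)
  finally show ?thesis .
qed

section \<open>Error propagation for a general sequence of nonnegative approximations\<close>

context
  fixes M :: "('m::{finite,linorder}, 'd::{finite,linorder}, 'n::finite) ssm"
    and y :: "nat \<Rightarrow> real ^ 'n"
    and u :: "nat \<Rightarrow> ('m, 'd) joint \<Rightarrow> real"
    and \<epsilon> :: "nat \<Rightarrow> real"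
    and h :: "nat \<Rightarrow> ennreal"
    and T :: enat
  assumes M: "state_space_model M"
    and y: "\<And>t. t \<in> times_upto T \<Longrightarrow> y t \<in> data_space M"
    and u: "\<And>t. t \<in> times_upto T \<Longrightarrow> u t \<in> borel_measurable (lborel_on (joint_space M))"
    and u_nonneg: "\<And>t z. t \<in> times_upto T \<Longrightarrow> z \<in> joint_space M \<Longrightarrow> 0 \<le> u t z"
    and h: "\<And>t. t \<in> times_upto T \<Longrightarrow> bound_f M y t \<le> h t"
    and error: "\<And>t. t \<in> times_upto T \<Longrightarrow>
      L2_norm_on (joint_space M) (\<lambda>z. sqrt (u t z) - sqrt (approx_target M y u t z)) \<le> ennreal (\<epsilon> t)"
begin

lemma approx_target_measurable:
  assumes "t \<in> times_upto T"
  shows "approx_target M y u t \<in> borel_measurable (lborel_on (joint_space M))"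
proof -
  \<comment> \<open>From time 2 on the target is built from the previous approximation, whose
    measurability is known only at times in \<open>times_upto T\<close>.\<close>
  have "t \<noteq> 1 \<Longrightarrow> t - 1 \<in> times_upto T"
    using assms times_upto_Suc[of "t - 1" T] by (auto simp: times_upto_def)
  then show ?thesis
    unfolding approx_target_def using M y assms
    by (intro borel_measurable_update)
       (auto intro!: borel_measurable_prior borel_measurable_marginal u state_space_model_borel)
qed

text \<open>For \<open>t \<ge> 1\<close> both functions at time \<open>Suc t\<close> are updates of
  marginals with the same data, so the update estimate followed by the marginal estimate bounds
  their distance by the error at time \<open>t\<close>.\<close>

lemma approx_target_error:
  assumes "Suc t \<in> times_upto T" "1 \<le> t"
  shows "L2_norm_on (joint_space M)
      (\<lambda>z. sqrt (approx_target M y u (Suc t) z) - sqrt (posterior M y (Suc t) z))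
    \<le> ennsqrt (h (Suc t)) *
      L2_norm_on (joint_space M) (\<lambda>z. sqrt (u t z) - sqrt (posterior M y t z))"
proof -
  note t = times_upto_Suc[OF assms]
  note XP = state_space_model_borel[OF M]
  have "L2_norm_on (joint_space M)
      (\<lambda>z. sqrt (approx_target M y u (Suc t) z) - sqrt (posterior M y (Suc t) z))
      \<le> ennsqrt (bound_f M y (Suc t)) * L2_norm_on (states M \<times> params M)
          (\<lambda>z. sqrt (marginal M (u t) z) - sqrt (marginal M (posterior M y t) z))"
    using L2_norm_on_update_le[where y = y, OF M y[OF assms(1)] borel_measurable_marginal[OF XP u[OF t]]
        borel_measurable_marginal[OF XP posterior_measurable[OF M y t]]] assms(2)
    by (simp add: approx_target_def)
  also have "\<dots> \<le> ennsqrt (h (Suc t)) *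
      L2_norm_on (joint_space M) (\<lambda>z. sqrt (u t z) - sqrt (posterior M y t z))"
    using h[OF assms(1)] u[OF t] u_nonneg[OF t] posterior_measurable[OF M y t] posterior_nonneg[OF M y t]
    by (intro mult_mono ennsqrt_mono L2_norm_on_marginal_le[OF XP]) auto
  finally show ?thesis .
qed

text \<open>Unrolls the error recursion down to time 1. The supremum is taken in
  \<open>ennreal\<close>, so the estimate also covers an infinite supremum of finite one-step
  constants.\<close>

lemma accumulated_error:
  assumes "t \<in> times_upto T"
  shows "L2_norm_on (joint_space M) (\<lambda>z. sqrt (u t z) - sqrt (posterior M y t z))
    \<le> (\<Sum>k=1..t. ennsqrt (SUP s\<in>times_upto T. h s) ^ (t - k) * ennreal (\<epsilon> k))"
  using assms
proof (induction t)
  case (Suc t)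
  let ?C = "ennsqrt (SUP s\<in>times_upto T. h s)"
  let ?E = "\<lambda>t. L2_norm_on (joint_space M) (\<lambda>z. sqrt (u t z) - sqrt (posterior M y t z))"
  let ?q = "approx_target M y u (Suc t)"
  show ?case
  proof (cases "t = 0")
    case True
    \<comment> \<open>At time 1 both sides are the update of the exact prior, so the whole error is
      the approximation error of this step.\<close>
    have "?q = posterior M y (Suc t)"
      using True by (simp add: approx_target_def)
    then show ?thesis
      using error[OF Suc.prems] True by simp
  next
    case False
    then have t: "1 \<le> t"
      by simp
    have [measurable]: "u (Suc t) \<in> borel_measurable (lborel_on (joint_space M))"
      "?q \<in> borel_measurable (lborel_on (joint_space M))"
      "posterior M y (Suc t) \<in> borel_measurable (lborel_on (joint_space M))"
      using Suc.prems
      by (auto intro!: u approx_target_measurable posterior_measurable[OF M y] simp del: posterior.simps)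
    have "?E (Suc t) \<le> L2_norm_on (joint_space M) (\<lambda>z. sqrt (u (Suc t) z) - sqrt (?q z))
        + L2_norm_on (joint_space M) (\<lambda>z. sqrt (?q z) - sqrt (posterior M y (Suc t) z))"
      using L2_norm_on_triangle[of "\<lambda>z. sqrt (u (Suc t) z) - sqrt (?q z)" "joint_space M"
          "\<lambda>z. sqrt (?q z) - sqrt (posterior M y (Suc t) z)"]
      by (simp del: posterior.simps)
    also have "\<dots> \<le> ennreal (\<epsilon> (Suc t)) + ennsqrt (h (Suc t)) * ?E t"
      by (intro add_mono error approx_target_error Suc.prems t)
    \<comment> \<open>The constant of this step is majorized by the supremum, which makes the
      factors uniform and lets them combine into powers.\<close>
    also have "\<dots> \<le> ennreal (\<epsilon> (Suc t)) + ?C * (\<Sum>k=1..t. ?C ^ (t - k) * ennreal (\<epsilon> k))"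
      using Suc.IH[OF times_upto_Suc[OF Suc.prems t]] Suc.prems
      by (intro add_left_mono mult_mono ennsqrt_mono SUP_upper) auto
    \<comment> \<open>Every old error gains one factor \<open>?C\<close>; the new error is the
      summand \<open>k = Suc t\<close>, with exponent \<open>0\<close>.\<close>
    also have "?C * (\<Sum>k=1..t. ?C ^ (t - k) * ennreal (\<epsilon> k))
        = (\<Sum>k=1..t. ?C ^ (Suc t - k) * ennreal (\<epsilon> k))"
      by (simp add: sum_distrib_left Suc_diff_le mult.assoc)
    finally show ?thesis
      by (simp add: add.commute)
  qed
qed (simp add: times_upto_def)

end

section \<open>Hellinger bound for the squared tensor-train algorithm\<close>

theorem theorem8:
  fixes M :: "('m::{finite,linorder}, 'd::{finite,linorder}, 'n::finite) ssm"
    and y :: "nat \<Rightarrow> real ^ 'n"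
    and \<rho> :: "('m, 'd) joint \<Rightarrow> real"
    and \<phi> :: "nat \<Rightarrow> ('m, 'd) joint \<Rightarrow> real"
    and \<tau> \<epsilon> :: "nat \<Rightarrow> real"
    and h :: "nat \<Rightarrow> ennreal"
    and T :: enat
  assumes model: "state_space_model M"
    and data: "\<forall>t\<in>times_upto T. y t \<in> data_space M"
    and evidence: "\<forall>t\<in>times_upto T.
          integrable (lborel_on (joint_space M)) (posterior M y t) \<and> 0 < evidence M y t"
    and reference: "reference_density M \<rho>"
    and algorithm: "\<forall>t\<in>times_upto T. tt_step M y \<rho> \<phi> \<tau> t"
    and h: "h \<in> {bound_f M y, bound_g M y}"
    and bounded: "\<forall>t\<in>times_upto T. h t < \<infinity>"
    and error: "\<forall>t\<in>times_upto T. 0 \<le> \<epsilon> t \<and>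
          L2_norm_on (joint_space M)
            (\<lambda>z. sqrt (tt_approx \<rho> \<phi> \<tau> t z)
                 - sqrt (approx_target M y (tt_approx \<rho> \<phi> \<tau>) t z)) \<le> ennreal (\<epsilon> t)"
  shows "\<forall>t\<in>times_upto T.
          hellinger_on (joint_space M)
            (normalized_on (joint_space M) (tt_approx \<rho> \<phi> \<tau> t))
            (normalized_on (joint_space M) (posterior M y t))
          \<le> ennreal (sqrt 2 / sqrt (evidence M y t)) *
            (\<Sum>k=1..t. ennsqrt (SUP s\<in>times_upto T. h s) ^ (t - k) * ennreal (\<epsilon> k))"
proof
  let ?u = "tt_approx \<rho> \<phi> \<tau>"
  have y: "y t \<in> data_space M" if "t \<in> times_upto T" for t
    using data that by blast
  have u: "?u t \<in> borel_measurable (lborel_on (joint_space M))" if "t \<in> times_upto T" for t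
  proof -
    have [measurable]: "\<phi> t \<in> borel_measurable (lborel_on (joint_space M))"
      "\<rho> \<in> borel_measurable (lborel_on (joint_space M))"
      using algorithm that reference
      by (auto simp: tt_step_def Let_def intro: borel_measurable_reference_density)
    show ?thesis
      unfolding tt_approx_def by measurable
  qed
  have u_nonneg: "0 \<le> ?u t z" if "t \<in> times_upto T" "z \<in> joint_space M" for t z
    using algorithm that reference_density_nonneg[OF reference that(2)]
    by (auto simp: tt_approx_def tt_step_def Let_def)
  \<comment> \<open>Equality if \<open>h\<close> is \<open>bound_f M y\<close>; otherwise the
    comparison with \<open>bound_g\<close>.\<close>
  have f_le_h: "bound_f M y t \<le> h t" if "t \<in> times_upto T" for t
    using h bound_f_le_bound_g[where y = y, OF model y[OF that]] by auto
  have err: "L2_norm_on (joint_space M) (\<lambda>z. sqrt (?u t z) - sqrt (approx_target M y ?u t z))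
      \<le> ennreal (\<epsilon> t)" if "t \<in> times_upto T" for t
    using error that by blast
  fix t assume t: "t \<in> times_upto T"
  have nonneg: "0 \<le> posterior M y t z" if "z \<in> joint_space M" for z
    using posterior_nonneg[OF model y t that] .
  \<comment> \<open>The integral that normalizes \<open>posterior M y t\<close> is the evidence,
    whose positivity is what the normalization estimate requires.\<close>
  have "hellinger_on (joint_space M) (normalized_on (joint_space M) (?u t))
        (normalized_on (joint_space M) (posterior M y t))
      \<le> ennreal (sqrt 2 / sqrt (evidence M y t)) *
        L2_norm_on (joint_space M) (\<lambda>z. sqrt (?u t z) - sqrt (posterior M y t z))"
    using hellinger_on_normalized_le[OF u[OF t] u_nonneg[OF t]] evidence t nonneg
    by (auto simp: evidence_def)
  also have "\<dots> \<le> ennreal (sqrt 2 / sqrt (evidence M y t)) *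
      (\<Sum>k=1..t. ennsqrt (SUP s\<in>times_upto T. h s) ^ (t - k) * ennreal (\<epsilon> k))"
    by (rule mult_left_mono[OF accumulated_error[OF model y u u_nonneg f_le_h err t] zero_le])
  finally show "hellinger_on (joint_space M) (normalized_on (joint_space M) (?u t))
        (normalized_on (joint_space M) (posterior M y t))
      \<le> ennreal (sqrt 2 / sqrt (evidence M y t)) *
        (\<Sum>k=1..t. ennsqrt (SUP s\<in>times_upto T. h s) ^ (t - k) * ennreal (\<epsilon> k))" .
qed

end
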